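(* For every integer $n\ge 1$, $$P^{\mathrm{Abs}}_{D_n}(q,1,-1)=-\tfrac{1}{2}(q-1)^{n-1}\left((1+q)^n+(1-q)^n\right).$$
   Context: $B_n$ is the set of pairs $\sigma=(z,\tau)$ with $z=(z_1,\dots,z_n)\in\{0,1\}^n$, $\tau\in S_n$ (signed permutations), and $D_n=\{\sigma\in B_n:\sum_i z_i\equiv 0 \pmod 2\}$. Statistics: $\mathrm{exc}(|\sigma|)=\#\{i\in[n]:\tau(i)>i\}$; $\mathrm{csum}(\sigma)=\sum_{i=1}^n z_i$ (as integers); $\mathrm{cyc}(\sigma)$ = number of cycles of $\tau$; $\mathrm{fix}(\sigma)=\#\{i:\tau(i)=i\}$. Define $\mathrm{exc}^{\mathrm{Abs}}(\sigma)=\mathrm{exc}(|\sigma|)+\mathrm{csum}(\sigma)$ and $P^{\mathrm{Abs}}_{D_n}(q,t,s)=\sum_{\sigma\in D_n}q^{\mathrm{exc}^{\mathrm{Abs}}(\sigma)}t^{\mathrm{fix}(\sigma)}s^{\mathrm{cyc}(\sigma)}$. *)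

theory Defs
  imports Complex_Main "HOL-Library.FuncSet" "HOL-Combinatorics.Permutations" "HOL-Combinatorics.Orbits"
begin

type_synonym signed_perm = "(nat \<Rightarrow> nat) \<times> (nat \<Rightarrow> nat)"

definition B :: "nat \<Rightarrow> signed_perm set" where
  "B n = ({1..n} \<rightarrow>\<^sub>E {0, 1}) \<times> {\<tau>. \<tau> permutes {1..n}}"

definition csum :: "nat \<Rightarrow> signed_perm \<Rightarrow> nat" where
  "csum n \<sigma> = (\<Sum>i = 1..n. fst \<sigma> i)"

definition D :: "nat \<Rightarrow> signed_perm set" where
  "D n = {\<sigma> \<in> B n. even (csum n \<sigma>)}"

definition exc_under :: "nat \<Rightarrow> signed_perm \<Rightarrow> nat" where
  "exc_under n \<sigma> = card {i \<in> {1..n}. snd \<sigma> i > i}"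

definition exc_Abs :: "nat \<Rightarrow> signed_perm \<Rightarrow> nat" where
  "exc_Abs n \<sigma> = exc_under n \<sigma> + csum n \<sigma>"

definition fixp :: "nat \<Rightarrow> signed_perm \<Rightarrow> nat" where
  "fixp n \<sigma> = card {i \<in> {1..n}. snd \<sigma> i = i}"

text \<open>Each cycle is identified with its support; fixed points count as cycles of length one.\<close>

definition cyc :: "nat \<Rightarrow> signed_perm \<Rightarrow> nat" where
  "cyc n \<sigma> = card (orbit (snd \<sigma>) ` {1..n})"

definition P_Abs_D :: "nat \<Rightarrow> 'a::comm_ring_1 \<Rightarrow> 'a \<Rightarrow> 'a \<Rightarrow> 'a" where
  "P_Abs_D n q t s = (\<Sum>\<sigma>\<in>D n. q ^ exc_Abs n \<sigma> * t ^ fixp n \<sigma> * s ^ cyc n \<sigma>)"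

end

theory Submission
  imports Defs "HOL-Combinatorics.Cycles" "Jordan_Normal_Form.Determinant"
begin

text \<open>
  The sum over \<open>D\<^sub>n\<close> is the product of a sum over sign vectors, which is the even part of
  \<open>(1 + q)\<^sup>n\<close>, and a sum over permutations. Since \<open>-1\<close> to the number of cycles is \<open>(-1)\<^sup>n\<close> times the
  sign of the permutation, the latter is, up to that factor, the determinant of the matrix with
  entries \<open>q\<close> above the diagonal and \<open>1\<close> elsewhere. That matrix is the all-ones lower triangular
  matrix times an upper triangular one with diagonal \<open>1, 1 - q, \<dots>, 1 - q\<close>.
\<close>

lemma sign_cycle_of_list:
  assumes "distinct cs"
  shows "sign (cycle_of_list cs) = (- 1) ^ (length cs - 1)"
  using assms
proof (induction cs rule: cycle_of_list.induct)
  case (1 i j cs)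
  have "sign (cycle_of_list (i # j # cs)) = sign (transpose i j) * sign (cycle_of_list (j # cs))"
    unfolding cycle_of_list.simps
    by (intro sign_compose permutation_swap_id permutation_of_cycle)
  then show ?case
    using 1 by (simp add: sign_swap_id del: cycle_of_list.simps)
qed simp_all

lemma cyclic_on_cycle_of_list:
  assumes "distinct cs" "cs \<noteq> []"
  shows "cyclic_on (cycle_of_list cs) (set cs)"
proof (rule cyclic_on_singleI)
  have funpow_hd: "(cycle_of_list cs ^^ k) (hd cs) = cs ! (k mod length cs)" for k
  proof -
    have "(cycle_of_list cs ^^ k) (hd cs) = hd (rotate k cs)"
      using assms cyclic_rotation[of cs k] by (metis hd_map)
    also have "\<dots> = cs ! (k mod length cs)"
      using assms(2) by (rule hd_rotate_conv_nth)
    finally show ?thesis .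
  qed
  have "orbit (cycle_of_list cs) (hd cs) = range (\<lambda>k. cs ! (k mod length cs))"
    by (simp add: orbit_altdef_permutation permutation_of_cycle funpow_hd full_SetCompr_eq)
  also have "\<dots> = set cs"
  proof
    show "range (\<lambda>k. cs ! (k mod length cs)) \<subseteq> set cs"
      using assms(2) by auto
    show "set cs \<subseteq> range (\<lambda>k. cs ! (k mod length cs))"
    proof
      fix x assume "x \<in> set cs"
      then obtain k where "k < length cs" "x = cs ! k"
        by (auto simp: in_set_conv_nth)
      then show "x \<in> range (\<lambda>k. cs ! (k mod length cs))"
        by (intro range_eqI[of _ _ k]) simp
    qed
  qed
  finally show "set cs = orbit (cycle_of_list cs) (hd cs)" ..
qed (use assms in simp)

lemma cycle_decomp_imp_permutes:
  assumes "cycle_decomp S p"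
  shows "finite S" "p permutes S"
  using assms
proof (induction rule: cycle_decomp.induct)
  case empty
  { case 1 show ?case by simp }
  { case 2 show ?case by (rule permutes_id) }
next
  case (comp I p cs)
  { case 1 show ?case using comp.IH by simp }
  { case 2 show ?case
      using permutes_subset[OF cycle_permutes[of cs]] permutes_subset[OF comp.IH(2)]
      by (intro permutes_compose) auto }
qed

lemma orbit_image_comp_disjoint:
  assumes "finite S" "p permutes S" "c permutes C" "cyclic_on c C" "C \<inter> S = {}"
  shows "orbit (c \<circ> p) ` (C \<union> S) = insert C (orbit p ` S)"
proof -
  have "orbit (c \<circ> p) x = C" if "x \<in> C" for x
    using permutes_comp_preserves_cyclic1[OF assms(2,4,5) order.refl] that
    by (rule orbit_cyclic_eq3)
  moreover have "C \<noteq> {}"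
    using assms(4) by (simp add: cyclic_on_alldef)
  ultimately have "orbit (c \<circ> p) ` C = {C}"
    by auto
  moreover have "orbit (c \<circ> p) ` S = orbit p ` S"
  proof (rule image_cong[OF refl], rule orbit_cyclic_eq3)
    fix x assume "x \<in> S"
    show "cyclic_on (c \<circ> p) (orbit p x)"
      using assms(3) cyclic_on_orbit[OF assms(2,1)] assms(5)
        permutes_orbit_subset[OF assms(2) \<open>x \<in> S\<close>]
      by (rule permutes_comp_preserves_cyclic2)
    show "x \<in> orbit p x"
      using permutes_imp_permutation[OF assms(1,2)] by (rule permutation_self_in_orbit)
  qed
  ultimately show ?thesis
    by (simp add: image_Un)
qed

lemma sign_cycle_decomp:
  assumes "cycle_decomp S p"
  shows "sign p = (- 1) ^ (card S + card (orbit p ` S))"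
  using assms
proof (induction rule: cycle_decomp.induct)
  case empty
  show ?case by simp
next
  case (comp S p cs)
  note fin = cycle_decomp_imp_permutes(1)[OF comp.hyps(1)]
    and perm = cycle_decomp_imp_permutes(2)[OF comp.hyps(1)]
  show ?case
  proof (cases "cs = []")
    case True
    then show ?thesis using comp.IH by simp
  next
    case False
    have "set cs \<notin> orbit p ` S"
    proof
      assume "set cs \<in> orbit p ` S"
      then have "set cs \<subseteq> S"
        using permutes_orbit_subset[OF perm] by auto
      then show False
        using comp.hyps(3) False by (simp add: Int_absorb2)
    qed
    then have card_orbits:
      "card (orbit (cycle_of_list cs \<circ> p) ` (set cs \<union> S)) = Suc (card (orbit p ` S))"
      using orbit_image_comp_disjoint[OF fin perm cycle_permutes
          cyclic_on_cycle_of_list[OF comp.hyps(2) False] comp.hyps(3)] fin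
      by simp
    have card_Un: "card (set cs \<union> S) = length cs + card S"
      using comp.hyps fin by (simp add: card_Un_disjoint distinct_card)
    have sign_comp: "sign (cycle_of_list cs \<circ> p) = (- 1) ^ (length cs - 1) * sign p"
      using comp.hyps(2) permutes_imp_permutation[OF fin perm]
      by (simp add: sign_compose permutation_of_cycle sign_cycle_of_list)
    obtain k where "length cs = Suc k"
      using False by (cases cs) auto
    then show ?thesis
      unfolding card_orbits card_Un sign_comp comp.IH by (simp add: power_add)
  qed
qed

lemma mat_threshold_eq_mult:
  fixes x y :: "'a::ring_1"
  shows "mat (Suc n) (Suc n) (\<lambda>(i, j). if i < j then x else y) =
    mat (Suc n) (Suc n) (\<lambda>(i, k). if k \<le> i then 1 else 0) *
    mat (Suc n) (Suc n) (\<lambda>(k, j). if k = 0 then if j = 0 then y else x else if k = j then y - x else 0)"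
    (is "?M = ?L * ?U")
proof (rule eq_matI)
  fix i j assume "i < dim_row (?L * ?U)" "j < dim_col (?L * ?U)"
  then have bounds: "i < Suc n" "j < Suc n" by simp_all
  have "(?L * ?U) $$ (i, j) = (\<Sum>k<Suc n. if k \<le> i then ?U $$ (k, j) else 0)"
    using bounds by (auto simp: scalar_prod_def lessThan_atLeast0 intro!: sum.cong)
  also have "\<dots> = ?U $$ (0, j) + (\<Sum>k<n. if Suc k \<le> i then ?U $$ (Suc k, j) else 0)"
    unfolding sum.lessThan_Suc_shift by simp
  also have "\<dots> = ?U $$ (0, j) + (\<Sum>k<n. if j = Suc k then if j \<le> i then y - x else 0 else 0)"
    using bounds by (intro arg_cong2[where f = "(+)"] sum.cong) auto
  also have "\<dots> = (if i < j then x else y)"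
    using bounds by (cases j) simp_all
  finally show "?M $$ (i, j) = (?L * ?U) $$ (i, j)"
    using bounds by simp
qed simp_all

lemma det_mat_threshold:
  fixes x y :: "'a::comm_ring_1"
  shows "det (mat (Suc n) (Suc n) (\<lambda>(i, j). if i < j then x else y)) = y * (y - x) ^ n"
proof -
  define L :: "'a mat" where
    "L = mat (Suc n) (Suc n) (\<lambda>(i, k). if k \<le> i then 1 else 0)"
  define U :: "'a mat" where
    "U = mat (Suc n) (Suc n)
       (\<lambda>(k, j). if k = 0 then if j = 0 then y else x else if k = j then y - x else 0)"
  have carrier: "L \<in> carrier_mat (Suc n) (Suc n)" "U \<in> carrier_mat (Suc n) (Suc n)"
    by (simp_all add: L_def U_def)
  have "det (mat (Suc n) (Suc n) (\<lambda>(i, j). if i < j then x else y)) = det L * det U"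
    unfolding mat_threshold_eq_mult L_def[symmetric] U_def[symmetric]
    using carrier by (rule det_mult)
  also have "det L = 1"
    using det_lower_triangular[OF _ carrier(1)]
    by (simp add: L_def prod_list_diag_prod)
  also have "det U = prod_list (diag_mat U)"
    using carrier(2) by (intro det_upper_triangular) (auto simp: U_def upper_triangular_def)
  also have "\<dots> = (\<Prod>k = 0..<Suc n. U $$ (k, k))"
    by (simp add: prod_list_diag_prod carrier_matD(1)[OF carrier(2)] del: prod.op_ivl_Suc)
  also have "\<dots> = U $$ (0, 0) * (\<Prod>k = 0..<n. U $$ (Suc k, Suc k))"
    by (simp add: prod.atLeast0_lessThan_Suc_shift del: prod.op_ivl_Suc)
  also have "\<dots> = y * (y - x) ^ n"
    by (simp add: U_def)
  finally show ?thesis by simp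
qed

lemma bij_betw_map_permutation:
  assumes "bij_betw f S T"
  shows "bij_betw (map_permutation S f) {p. p permutes S} {p. p permutes T}"
proof (rule bij_betw_byWitness)
  have inv: "bij_betw (inv_into S f) T S"
    using assms by (rule bij_betw_inv_into)
  show "\<forall>p\<in>{p. p permutes S}. map_permutation T (inv_into S f) (map_permutation S f p) = p"
    using map_permutation_compose_inv[OF assms] bij_betw_inv_into_left[OF assms] by blast
  show "\<forall>p\<in>{p. p permutes T}. map_permutation S f (map_permutation T (inv_into S f) p) = p"
    using map_permutation_compose_inv[OF inv] bij_betw_inv_into_right[OF assms] by blast
  show "map_permutation S f ` {p. p permutes S} \<subseteq> {p. p permutes T}"
    using map_permutation_permutes[OF assms] by blast
  show "map_permutation T (inv_into S f) ` {p. p permutes T} \<subseteq> {p. p permutes S}"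
    using map_permutation_permutes[OF inv] by blast
qed

lemma sum_sign_prod_reindex:
  assumes "bij_betw f S T" "finite S"
  shows "(\<Sum>p | p permutes T. of_int (sign p) * (\<Prod>i\<in>T. a i (p i)))
    = (\<Sum>p | p permutes S. of_int (sign p) * (\<Prod>i\<in>S. a (f i) (f (p i))))"
proof -
  have inj: "inj_on f S"
    using assms(1) by (rule bij_betw_imp_inj_on)
  have "(\<Sum>p | p permutes T. of_int (sign p) * (\<Prod>i\<in>T. a i (p i)))
    = (\<Sum>p | p permutes S. of_int (sign (map_permutation S f p)) *
        (\<Prod>i\<in>S. a (f i) (map_permutation S f p (f i))))"
    unfolding sum.reindex_bij_betw[OF bij_betw_map_permutation[OF assms(1)], symmetric]
      prod.reindex_bij_betw[OF assms(1), symmetric] ..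
  also have "\<dots> = (\<Sum>p | p permutes S. of_int (sign p) * (\<Prod>i\<in>S. a (f i) (f (p i))))"
    using assms(2) inj by (simp add: sign_map_permutation map_permutation_apply)
  finally show ?thesis .
qed

definition excedances :: "'a::ord set \<Rightarrow> ('a \<Rightarrow> 'a) \<Rightarrow> 'a set" where
  "excedances S p = {i \<in> S. i < p i}"

lemma sum_sign_power_excedances:
  fixes S :: "'b::linorder set" and q :: "'a::comm_ring_1"
  assumes "finite S" "S \<noteq> {}"
  shows "(\<Sum>p | p permutes S. of_int (sign p) * q ^ card (excedances S p)) = (1 - q) ^ (card S - 1)"
proof -
  obtain n where n: "card S = Suc n"
    using assms by (metis card_eq_0_iff not0_implies_Suc)
  let ?h = "(!) (sorted_list_of_set S)"
  have nth_less_iff: "?h i < ?h j \<longleftrightarrow> i < j" if "i < Suc n" "j < Suc n" for i j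
    using that n sorted_wrt_nth_less[OF strict_sorted_list_of_set[of S]]
    by (metis length_sorted_list_of_set linorder_neq_iff order_less_asym)
  have "(\<Sum>p | p permutes S. of_int (sign p) * q ^ card (excedances S p))
    = (\<Sum>p | p permutes S. of_int (sign p) * (\<Prod>i\<in>S. if i < p i then q else 1))"
    using assms(1) by (simp add: excedances_def prod.If_cases Int_def)
  also have "\<dots> = (\<Sum>p | p permutes {0..<Suc n}.
      of_int (sign p) * (\<Prod>i = 0..<Suc n. if ?h i < ?h (p i) then q else 1))"
  proof (rule sum_sign_prod_reindex)
    show "bij_betw ?h {0..<Suc n} S"
      using assms(1) n by (intro bij_betw_nth) auto
  qed simp
  also have "\<dots> = (\<Sum>p | p permutes {0..<Suc n}.
      of_int (sign p) * (\<Prod>i = 0..<Suc n. if i < p i then q else 1))"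
  proof (intro sum.cong prod.cong refl arg_cong2[where f = "(*)"])
    fix p i assume "p \<in> {p. p permutes {0..<Suc n}}" "i \<in> {0..<Suc n}"
    then have "i < Suc n" "p i < Suc n"
      using permutes_in_image[of p "{0..<Suc n}" i] by auto
    then show "(if ?h i < ?h (p i) then q else 1) = (if i < p i then q else 1)"
      by (simp only: nth_less_iff)
  qed
  also have "\<dots> = det (mat (Suc n) (Suc n) (\<lambda>(i, j). if i < j then q else 1))"
    by (subst det_def'[of _ "Suc n"])
      (auto simp del: prod.op_ivl_Suc dest: permutes_in_image intro!: sum.cong prod.cong)
  also have "\<dots> = (1 - q) ^ (card S - 1)"
    by (simp add: det_mat_threshold n)
  finally show ?thesis .
qed

lemma sum_minus_one_power_cycles_power_excedances:
  fixes S :: "'b::linorder set" and q :: "'a::comm_ring_1"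
  assumes "finite S" "S \<noteq> {}"
  shows "(\<Sum>p | p permutes S. (- 1) ^ card (orbit p ` S) * q ^ card (excedances S p))
    = - ((q - 1) ^ (card S - 1))"
proof -
  obtain n where n: "card S = Suc n"
    using assms by (metis card_eq_0_iff not0_implies_Suc)
  have minus_one_power_cycles:
    "(- 1) ^ card (orbit p ` S) = (- 1) ^ card S * (of_int (sign p) :: 'a)" if "p permutes S" for p
    using sign_cycle_decomp[OF cycle_decomposition[OF that assms(1)]]
    by (simp add: power_add)
  have "(\<Sum>p | p permutes S. (- 1) ^ card (orbit p ` S) * q ^ card (excedances S p))
    = (- 1) ^ card S * (\<Sum>p | p permutes S. of_int (sign p) * q ^ card (excedances S p))"
    by (simp add: minus_one_power_cycles sum_distrib_left mult.assoc)
  also have "\<dots> = - ((- 1) ^ n * (1 - q) ^ n)"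
    using assms by (simp add: sum_sign_power_excedances n)
  also have "\<dots> = - ((q - 1) ^ (card S - 1))"
    by (simp add: n flip: power_mult_distrib)
  finally show ?thesis .
qed

lemma sum_power_sum_PiE_01:
  fixes q :: "'a::comm_semiring_1"
  assumes "finite I"
  shows "(\<Sum>z\<in>I \<rightarrow>\<^sub>E {0, 1::nat}. q ^ (\<Sum>i\<in>I. z i)) = (1 + q) ^ card I"
proof -
  have "(\<Sum>z\<in>I \<rightarrow>\<^sub>E {0, 1::nat}. q ^ (\<Sum>i\<in>I. z i)) = (\<Sum>z\<in>I \<rightarrow>\<^sub>E {0, 1::nat}. \<Prod>i\<in>I. q ^ z i)"
    by (simp add: power_sum)
  also have "\<dots> = (\<Prod>i\<in>I. \<Sum>k\<in>{0, 1::nat}. q ^ k)"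
    using assms by (subst prod_sum_PiE) auto
  finally show ?thesis by simp
qed

lemma sum_even_power:
  fixes q :: "'a::comm_ring_1"
  assumes "finite A"
  shows "2 * (\<Sum>x | x \<in> A \<and> even (f x). q ^ f x) = (\<Sum>x\<in>A. q ^ f x) + (\<Sum>x\<in>A. (- q) ^ f x)"
proof -
  have "(\<Sum>x\<in>A. q ^ f x) + (\<Sum>x\<in>A. (- q) ^ f x) = (\<Sum>x\<in>A. if even (f x) then 2 * q ^ f x else 0)"
    unfolding sum.distrib[symmetric] by (intro sum.cong) auto
  also have "\<dots> = 2 * (\<Sum>x | x \<in> A \<and> even (f x). q ^ f x)"
    using assms by (simp add: sum_distrib_left flip: sum.inter_filter)
  finally show ?thesis ..
qed

lemma sum_even_power_sum_PiE_01:
  fixes q :: "'a::comm_ring_1"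
  assumes "finite I"
  shows "2 * (\<Sum>z | z \<in> I \<rightarrow>\<^sub>E {0, 1::nat} \<and> even (\<Sum>i\<in>I. z i). q ^ (\<Sum>i\<in>I. z i))
    = (1 + q) ^ card I + (1 - q) ^ card I"
  using sum_power_sum_PiE_01[OF assms, of q] sum_power_sum_PiE_01[OF assms, of "- q"] assms
  by (simp add: sum_even_power finite_PiE)

lemma D_eq_Times:
  "D n = {z \<in> {1..n} \<rightarrow>\<^sub>E {0, 1}. even (\<Sum>i = 1..n. z i)} \<times> {p. p permutes {1..n}}"
  by (auto simp: D_def B_def csum_def)

lemma P_Abs_D_1_eq_mult:
  "P_Abs_D n q 1 s =
    (\<Sum>z | z \<in> {1..n} \<rightarrow>\<^sub>E {0, 1::nat} \<and> even (\<Sum>i = 1..n. z i). q ^ (\<Sum>i = 1..n. z i)) *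
    (\<Sum>p | p permutes {1..n}. s ^ card (orbit p ` {1..n}) * q ^ card (excedances {1..n} p))"
  unfolding P_Abs_D_def D_eq_Times sum_product sum.cartesian_product
  by (intro sum.cong)
    (auto simp: exc_Abs_def exc_under_def csum_def cyc_def excedances_def power_add mult_ac)

theorem theorem4:
  fixes n :: nat and q :: "'a::field_char_0"
  assumes "n \<ge> 1"
  shows "P_Abs_D n q 1 (-1) = - (1 / 2) * (q - 1) ^ (n - 1) * ((1 + q) ^ n + (1 - q) ^ n)"
proof -
  let ?signs = "\<Sum>z | z \<in> {1..n} \<rightarrow>\<^sub>E {0, 1::nat} \<and> even (\<Sum>i = 1..n. z i). q ^ (\<Sum>i = 1..n. z i)"
  let ?perms = "\<Sum>p | p permutes {1..n}. (- 1) ^ card (orbit p ` {1..n}) * q ^ card (excedances {1..n} p)"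
  have "P_Abs_D n q 1 (-1) = 1 / 2 * (2 * ?signs) * ?perms"
    unfolding P_Abs_D_1_eq_mult by simp
  also have "2 * ?signs = (1 + q) ^ n + (1 - q) ^ n"
    using sum_even_power_sum_PiE_01[of "{1..n}" q] by simp
  also have "?perms = - ((q - 1) ^ (n - 1))"
    using assms sum_minus_one_power_cycles_power_excedances[of "{1..n}" q] by simp
  finally show ?thesis by simp
qed

end
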